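(* Let $\rightsquigarrow_s^{(\infty)}=\bigcup_{k\ge 1}\rightsquigarrow_s^{(k)}$. Then $\rightsquigarrow_s^{(\infty)}\ =\ \equiv_{\mathsf{rf}}$ as relations on $\Sigma^*$.
   Context: Given finite sets $\mathcal{T}$ (threads) and $\mathcal{X}$ (memory locations), let $\Sigma=\{\langle t,op(x)\rangle : t\in\mathcal{T},\ op\in\{\mathtt{w},\mathtt{r}\},\ x\in\mathcal{X}\}$ ($\mathtt{w}$ = write, $\mathtt{r}$ = read). A run is a finite word $\sigma\in\Sigma^*$; the occurrences of letters in it are its events. The reads-from map $\mathsf{rf}_\sigma$ is the partial map sending each read event on a location $x$ to the last write event on $x$ preceding it in $\sigma$, undefined if there is no such write. Reads-from equivalence: $\sigma\equiv_{\mathsf{rf}}\rho$ iff for every thread $t$ the subsequence of events of thread $t$ is the same in $\sigma$ and $\rho$ (same events and same program order; so the $j$-th event of thread $t$ in $\sigma$ is identified with the $j$-th event of thread $t$ in $\rho$), and, under this identification, $\mathsf{rf}_\sigma=\mathsf{rf}_\rho$. $k$-sliced reordering: $\sigma\rightsquigarrow_s^{(k)}\rho$ iff $\sigma\equiv_{\mathsf{rf}}\rho$ and the events of $\sigma$ can be partitioned into $k+1$ disjoint (possibly empty) subsequences $\sigma_1,\dots,\sigma_{k+1}$ of $\sigma$ such that $\rho=\sigma_1\cdot\sigma_2\cdots\sigma_{k+1}$ as sequences of events (identifying, for every thread $t$ and every $j$, the $j$-th event of thread $t$ in $\sigma$ with the $j$-th event of thread $t$ in $\rho$). *)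

theory Defs
  imports Main
begin

datatype access = Write | Read

type_synonym ('t, 'x) letter = "'t \<times> access \<times> 'x"

abbreviation thread_of :: "('t, 'x) letter \<Rightarrow> 't" where
  "thread_of a \<equiv> fst a"

abbreviation access_of :: "('t, 'x) letter \<Rightarrow> access" where
  "access_of a \<equiv> fst (snd a)"

abbreviation loc_of :: "('t, 'x) letter \<Rightarrow> 'x" where
  "loc_of a \<equiv> snd (snd a)"

definition alphabet :: "'t set \<Rightarrow> 'x set \<Rightarrow> ('t, 'x) letter set" where
  "alphabet T X = T \<times> UNIV \<times> X"

text \<open>The events of a run are its positions. To compare events of different runs, position
  \<open>i\<close> is identified by its thread together with its index (from 0) within that thread.\<close>

definition event :: "('t, 'x) letter list \<Rightarrow> nat \<Rightarrow> 't \<times> nat" where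
  "event \<sigma> i = (thread_of (\<sigma> ! i), card {j. j < i \<and> thread_of (\<sigma> ! j) = thread_of (\<sigma> ! i)})"

definition events :: "('t, 'x) letter list \<Rightarrow> ('t \<times> nat) list" where
  "events \<sigma> = map (event \<sigma>) [0..<length \<sigma>]"

definition thread_proj :: "'t \<Rightarrow> ('t, 'x) letter list \<Rightarrow> ('t, 'x) letter list" where
  "thread_proj t \<sigma> = filter (\<lambda>a. thread_of a = t) \<sigma>"

definition prior_writes :: "('t, 'x) letter list \<Rightarrow> nat \<Rightarrow> nat set" where
  "prior_writes \<sigma> i =
    {j. j < i \<and> access_of (\<sigma> ! j) = Write \<and> loc_of (\<sigma> ! j) = loc_of (\<sigma> ! i)}"

definition rf :: "('t, 'x) letter list \<Rightarrow> nat \<Rightarrow> nat option" where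
  "rf \<sigma> i =
    (if i < length \<sigma> \<and> access_of (\<sigma> ! i) = Read \<and> prior_writes \<sigma> i \<noteq> {}
     then Some (Max (prior_writes \<sigma> i)) else None)"

definition rf_equiv ::
  "'t set \<Rightarrow> 'x set \<Rightarrow> (('t, 'x) letter list \<times> ('t, 'x) letter list) set" where
  "rf_equiv T X = {(\<sigma>, \<rho>).
     \<sigma> \<in> lists (alphabet T X) \<and> \<rho> \<in> lists (alphabet T X) \<and>
     (\<forall>t\<in>T. thread_proj t \<sigma> = thread_proj t \<rho>) \<and>
     (\<forall>i<length \<sigma>. \<forall>j<length \<rho>. event \<sigma> i = event \<rho> j \<longrightarrow>
        map_option (event \<sigma>) (rf \<sigma> i) = map_option (event \<rho>) (rf \<rho> j))}"

text \<open>The slices are given by sets \<open>I 0, \<dots>, I k\<close> of positions of \<open>\<sigma>\<close>, possibly empty;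
  slice \<open>m\<close> is the subsequence of \<open>\<sigma>\<close> at the positions in \<open>I m\<close>. Comparing sequences of event
  identifiers is enough, as \<open>rf_equiv\<close> makes identified events carry the same letter.\<close>

definition sliced_reordering ::
  "'t set \<Rightarrow> 'x set \<Rightarrow> nat \<Rightarrow> (('t, 'x) letter list \<times> ('t, 'x) letter list) set" where
  "sliced_reordering T X k = {(\<sigma>, \<rho>).
     (\<sigma>, \<rho>) \<in> rf_equiv T X \<and>
     (\<exists>I :: nat \<Rightarrow> nat set.
        (\<Union>m\<in>{..k}. I m) = {..<length \<sigma>} \<and>
        (\<forall>m\<in>{..k}. \<forall>n\<in>{..k}. m \<noteq> n \<longrightarrow> I m \<inter> I n = {}) \<and>
        events \<rho> = concat (map (\<lambda>m. nths (events \<sigma>) (I m)) [0..<Suc k]))}"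

definition sliced_reordering_inf ::
  "'t set \<Rightarrow> 'x set \<Rightarrow> (('t, 'x) letter list \<times> ('t, 'x) letter list) set" where
  "sliced_reordering_inf T X = (\<Union>k\<in>{1..}. sliced_reordering T X k)"

end

(* Cut \<sigma> into slices of at most one event each, in the order prescribed by \<rho>. Events are
   distinct and the thread projections determine the set of events, so runs related by
   \<open>rf_equiv\<close> have the same events and this partition always exists. *)

theory Submission
  imports Defs
begin

text \<open>An identifier counts only strictly earlier positions, so appending a letter leaves the
  existing ones unchanged. This recursion drives the \<open>rev_induct\<close> proofs below.\<close>

lemma events_snoc:
  "events (xs @ [a]) = events xs @ [(thread_of a, length (thread_proj (thread_of a) xs))]"
proof -
  have "event (xs @ [a]) i = event xs i" if "i < length xs" for i
  proof -
    have "{j. j < i \<and> thread_of ((xs @ [a]) ! j) = thread_of ((xs @ [a]) ! i)}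
        = {j. j < i \<and> thread_of (xs ! j) = thread_of (xs ! i)}"
      using that by (auto simp: nth_append)
    then show ?thesis
      using that by (simp add: event_def nth_append)
  qed
  moreover have "{j. j < length xs \<and> thread_of ((xs @ [a]) ! j) = thread_of a}
      = {j. j < length xs \<and> thread_of (xs ! j) = thread_of a}"
    by (auto simp: nth_append)
  then have "event (xs @ [a]) (length xs)
      = (thread_of a, length (thread_proj (thread_of a) xs))"
    by (simp add: event_def thread_proj_def length_filter_conv_card)
  ultimately show ?thesis
    by (simp add: events_def)
qed

text \<open>Each thread numbers its events consecutively from 0, so how threads interleave does not
  affect the set of identifiers.\<close>

lemma set_events: "set (events xs) = {(t, n). n < length (thread_proj t xs)}"
proof (induction xs rule: rev_induct)
  case Nil
  then show ?case by (simp add: events_def thread_proj_def)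
next
  case (snoc a xs)
  then show ?case by (auto simp: events_snoc thread_proj_def less_Suc_eq split: if_splits)
qed

text \<open>By \<open>set_events\<close>, the index given to an appended letter exceeds every index
  its thread has used so far.\<close>

lemma distinct_events: "distinct (events xs)"
proof (induction xs rule: rev_induct)
  case Nil
  then show ?case by (simp add: events_def)
next
  case (snoc a xs)
  then show ?case by (simp add: events_snoc set_events)
qed

lemma length_events [simp]: "length (events xs) = length xs"
  by (simp add: events_def)

text \<open>\<open>rf_equiv\<close> compares projections only for threads in \<open>T\<close>; this
  covers all other threads, so that \<open>set_events\<close> can be applied to every
  thread.\<close>

lemma thread_proj_eq_Nil:
  assumes "xs \<in> lists (alphabet T X)" and "t \<notin> T"
  shows "thread_proj t xs = []"
  using assms by (auto simp: thread_proj_def filter_empty_conv alphabet_def)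

lemma rf_equiv_set_events:
  assumes "(\<sigma>, \<rho>) \<in> rf_equiv T X"
  shows "set (events \<sigma>) = set (events \<rho>)"
proof -
  have "thread_proj t \<sigma> = thread_proj t \<rho>" for t
    using assms thread_proj_eq_Nil[of \<sigma> T X t] thread_proj_eq_Nil[of \<rho> T X t]
    by (cases "t \<in> T") (auto simp: rf_equiv_def)
  then show ?thesis by (simp add: set_events)
qed

lemma filter_eq_singleton:
  assumes "distinct xs" and "y \<in> set xs"
  shows "filter (\<lambda>x. x = y) xs = [y]"
  using assms by (induction xs) (auto simp: filter_empty_conv)

lemma permutation_slices:
  assumes "distinct xs" and "distinct ys" and eq: "set xs = set ys" and "length ys \<le> k"
  obtains I :: "nat \<Rightarrow> nat set" where
    "(\<Union>m\<in>{..k}. I m) = {..<length xs}"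
    "\<forall>m\<in>{..k}. \<forall>n\<in>{..k}. m \<noteq> n \<longrightarrow> I m \<inter> I n = {}"
    "ys = concat (map (\<lambda>m. nths xs (I m)) [0..<Suc k])"
proof
  \<comment> \<open>Slice \<open>m\<close> is the one position of \<open>xs\<close> that holds
    \<open>ys ! m\<close>. The conjunct \<open>m < length ys\<close> makes all slices from
    \<open>length ys\<close> up to \<open>k\<close> empty, so they only pad the
    concatenation.\<close>
  define I where "I m = {i. i < length xs \<and> m < length ys \<and> xs ! i = ys ! m}" for m
  show "(\<Union>m\<in>{..k}. I m) = {..<length xs}"
  proof -
    have "\<exists>m\<le>k. i \<in> I m" if "i < length xs" for i
    proof -
      have "xs ! i \<in> set ys" using that by (simp flip: eq)
      then obtain m where "m < length ys" "ys ! m = xs ! i"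
        by (auto simp: in_set_conv_nth)
      then show ?thesis
        using that assms(4) by (auto simp: I_def intro!: exI[of _ m])
    qed
    then show ?thesis by (auto simp: I_def)
  qed
  show "\<forall>m\<in>{..k}. \<forall>n\<in>{..k}. m \<noteq> n \<longrightarrow> I m \<inter> I n = {}"
    \<comment> \<open>A position shared by slices \<open>m\<close> and \<open>n\<close> would give
      \<open>ys ! m = ys ! n\<close>, hence \<open>m = n\<close> by distinctness of
      \<open>ys\<close>.\<close>
    using assms(2) by (auto simp: I_def nth_eq_iff_index_eq)
  have "nths xs (I m) = [ys ! m]" if "m < length ys" for m
  proof -
    have "nths xs (I m) = filter (\<lambda>x. x = ys ! m) xs"
      using that by (simp add: I_def filter_eq_nths)
    then show ?thesis
      using that assms(1) eq by (simp add: filter_eq_singleton)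
  qed
  then have "concat (map (\<lambda>m. nths xs (I m)) [0..<length ys])
      = concat (map (\<lambda>m. [ys ! m]) [0..<length ys])"
    by (intro arg_cong[of _ _ concat] map_cong) auto
  also have "\<dots> = ys"
    by (simp add: map_nth)
  finally have "concat (map (\<lambda>m. nths xs (I m)) [0..<length ys]) = ys" .
  moreover have "concat (map (\<lambda>m. nths xs (I m)) [length ys..<Suc k]) = []"
    by (auto simp: I_def)
  moreover have "[0..<Suc k] = [0..<length ys] @ [length ys..<Suc k]"
    using assms(4) by (metis le0 le_SucI le_add_diff_inverse upt_add_eq_append)
  ultimately show "ys = concat (map (\<lambda>m. nths xs (I m)) [0..<Suc k])"
    by simp
qed

theorem corollary5p8:
  fixes T :: "'t set" and X :: "'x set"
  assumes "finite T" and "finite X"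
  shows "sliced_reordering_inf T X = rf_equiv T X"
proof
  show "sliced_reordering_inf T X \<subseteq> rf_equiv T X"
    by (auto simp: sliced_reordering_inf_def sliced_reordering_def)
next
  show "rf_equiv T X \<subseteq> sliced_reordering_inf T X"
  proof clarify
    fix \<sigma> \<rho> :: "('t, 'x) letter list"
    assume rf: "(\<sigma>, \<rho>) \<in> rf_equiv T X"
    \<comment> \<open>Taking \<open>Suc (length \<rho>)\<close> for \<open>k\<close> guarantees
      \<open>k \<ge> 1\<close>, the lower bound in \<open>sliced_reordering_inf\<close>, even when
      \<open>\<rho>\<close> is empty.\<close>
    obtain I :: "nat \<Rightarrow> nat set" where
      "(\<Union>m\<in>{..Suc (length \<rho>)}. I m) = {..<length (events \<sigma>)}"
      "\<forall>m\<in>{..Suc (length \<rho>)}. \<forall>n\<in>{..Suc (length \<rho>)}. m \<noteq> n \<longrightarrow> I m \<inter> I n = {}"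
      "events \<rho> = concat (map (\<lambda>m. nths (events \<sigma>) (I m)) [0..<Suc (Suc (length \<rho>))])"
      by (rule permutation_slices[OF distinct_events distinct_events
            rf_equiv_set_events[OF rf], of "Suc (length \<rho>)"]) auto
    then have "(\<sigma>, \<rho>) \<in> sliced_reordering T X (Suc (length \<rho>))"
      unfolding sliced_reordering_def length_events using rf by blast
    then show "(\<sigma>, \<rho>) \<in> sliced_reordering_inf T X"
      unfolding sliced_reordering_inf_def by (intro UN_I[of "Suc (length \<rho>)"]) auto
  qed
qed

end
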